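(* Let $\kappa$ be an infinite cardinal and let $K_\kappa$ be the complete graph on $\kappa$. (1) If $\kappa$ is regular and $\kappa\nrightarrow[\kappa;\kappa]^2_2$, then there is an orientation $D$ of $K_\kappa$ such that for every $W\subseteq\kappa$ with $\chi(K_\kappa[W])=\kappa$ (i.e. $|W|=\kappa$) and every integer $n\geq3$, the directed cycle $\vec C_n$ is a subdigraph of $D[W]$. (2) If $\lambda$ is an uncountable cardinal, then there is an orientation $D$ of $K_{\lambda^+}$ such that for every colouring of the vertices of $D$ with $\lambda$ colours and every integer $n\geq 3$ there is a monochromatic copy of $\vec C_n$ in $D$.
   Context: An orientation of an undirected graph $G$ is a digraph on the same vertex set containing, for each edge $uv$ of $G$, exactly one of the arcs $uv$, $vu$, and no other arcs. $\vec C_n$ is the directed cycle on $n$ vertices; copies/subdigraphs are not necessarily induced. $\kappa\nrightarrow[\kappa;\kappa]^2_2$ means there is $f:[\kappa]^2\to 2$ such that for all $A,B\subseteq\kappa$ of size $\kappa$ and each $i<2$ there are $\alpha\in A$, $\beta\in B$ with $\alpha<\beta$ and $f(\alpha,\beta)=i$. *)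

theory Defs
  imports Main "HOL-Library.Countable_Set"
begin

unbundle cardinal_syntax

text \<open>A cardinal \<kappa> is represented by a set V together with a cardinal order r on V
  (i.e. r is a well-order of V that is an initial ordinal); its strict part
  gives the ordering \<alpha> < \<beta> of the elements of \<kappa>.\<close>

definition regular_card :: "'a set \<Rightarrow> 'a rel \<Rightarrow> bool" where
  "regular_card V r \<longleftrightarrow>
     (\<forall>A. A \<subseteq> V \<and> |A| <o |V| \<longrightarrow> (\<exists>\<beta>\<in>V. \<forall>\<alpha>\<in>A. (\<alpha>, \<beta>) \<in> r))"

text \<open>\<kappa> \<nrightarrow> [\<kappa>;\<kappa>]^2_2 ; a colouring of [\<kappa>]^2 is given by its value f \<alpha> \<beta> on pairs \<alpha> < \<beta>.\<close>
definition neg_square_bracket :: "'a set \<Rightarrow> 'a rel \<Rightarrow> bool" where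
  "neg_square_bracket V r \<longleftrightarrow>
     (\<exists>f :: 'a \<Rightarrow> 'a \<Rightarrow> bool.
        \<forall>A B. A \<subseteq> V \<and> B \<subseteq> V \<and> |A| =o |V| \<and> |B| =o |V| \<longrightarrow>
          (\<forall>i. \<exists>\<alpha>\<in>A. \<exists>\<beta>\<in>B. (\<alpha>, \<beta>) \<in> r \<and> \<alpha> \<noteq> \<beta> \<and> f \<alpha> \<beta> = i))"

definition orientation_complete :: "'a set \<Rightarrow> 'a rel \<Rightarrow> bool" where
  "orientation_complete V D \<longleftrightarrow>
     D \<subseteq> V \<times> V \<and> (\<forall>u\<in>V. (u, u) \<notin> D) \<and>
     (\<forall>u\<in>V. \<forall>v\<in>V. u \<noteq> v \<longrightarrow> ((u, v) \<in> D \<longleftrightarrow> (v, u) \<notin> D))"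

definition has_dicycle_in :: "'a rel \<Rightarrow> 'a set \<Rightarrow> nat \<Rightarrow> bool" where
  "has_dicycle_in D W n \<longleftrightarrow>
     (\<exists>x :: nat \<Rightarrow> 'a. inj_on x {..<n} \<and> x ` {..<n} \<subseteq> W \<and>
        (\<forall>i<n. (x i, x (Suc i mod n)) \<in> D))"

end

theory Submission
  imports Defs
begin

text \<open>
  Both orientations come from a function \<open>f\<close> on pairs \<open>u < v\<close>: the arc points upwards iff \<open>f u v\<close>.

  For (1), \<open>f\<close> witnesses the negative partition relation. By regularity every large \<open>W\<close> contains a
  vertex \<open>x\<close> with \<open>\<kappa>\<close> many out-neighbours \<open>B\<close> and \<open>\<kappa>\<close> many in-neighbours \<open>C\<close> above it, and for
  every \<open>m \<ge> 1\<close> there is an increasing directed path with \<open>m\<close> vertices in \<open>B\<close> followed by one in \<open>C\<close>.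

  For (2), give each vertex \<open>v\<close> a label \<open>(a, b)\<close>, every pair being used \<open>\<lambda>\<^sup>+\<close> many times, and let
  \<open>f u v\<close> say that \<open>a \<le> u < b\<close>. Given a colouring, three applications of the pigeonhole principle
  (over \<open>v\<close> for fixed \<open>(a, b)\<close>, then over \<open>b\<close> for fixed \<open>a\<close>, then over \<open>a\<close>) yield one colour and
  arbitrarily many disjoint intervals \<open>[a\<^sub>k, b\<^sub>k)\<close>, each containing a vertex \<open>x\<^sub>k\<close> of that colour, for
  which there are vertices \<open>p\<^sub>k\<close> of that colour labelled \<open>(a\<^sub>k, b\<^sub>k)\<close> and lying above everything.
  Then \<open>x\<^sub>k\<close> sends an arc to \<open>p\<^sub>k\<close> and receives arcs from all other \<open>p\<^sub>j\<close>, which gives the cycle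
  \<open>x\<^sub>0 p\<^sub>0 x\<^sub>1 p\<^sub>1 \<dots> x\<^sub>m p\<^sub>m\<close>; if \<open>p\<^sub>0\<close> is the least of the \<open>p\<^sub>k\<close>, then \<open>x\<^sub>0\<close> may be omitted, which
  settles odd lengths.
\<close>

section \<open>Directed cycles read off closed lists\<close>

lemma has_dicycle_in_path:
  assumes "distinct xs" "set xs \<subseteq> W" "successively (\<lambda>u v. (u, v) \<in> D) xs"
    "xs \<noteq> []" "(last xs, hd xs) \<in> D"
  shows "has_dicycle_in D W (length xs)"
  unfolding has_dicycle_in_def
proof (intro exI[of _ "\<lambda>i. xs ! i"] conjI allI impI)
  show "inj_on ((!) xs) {..<length xs}"
    using assms(1) by (simp add: inj_on_nth)
  show "(!) xs ` {..<length xs} \<subseteq> W"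
    using assms(2) by auto
  fix i assume i: "i < length xs"
  show "(xs ! i, xs ! (Suc i mod length xs)) \<in> D"
  proof (cases "Suc i = length xs")
    case True
    then have "i = length xs - 1" by simp
    then show ?thesis
      using assms(4,5) True by (simp add: last_conv_nth hd_conv_nth)
  next
    case False
    then show ?thesis
      using assms(3) i by (simp add: successively_conv_nth)
  qed
qed

section \<open>Cardinal orders, sets of full size, orientations coming from colourings\<close>

locale infinite_card =
  fixes V :: "'a set" and r :: "'a rel"
  assumes infinite_V: "infinite V" and card_order_r: "card_order_on V r"
begin

definition less :: "'a \<Rightarrow> 'a \<Rightarrow> bool" (infix "\<prec>" 50) where
  "u \<prec> v \<longleftrightarrow> (u, v) \<in> r \<and> u \<noteq> v"

definition large :: "'a set \<Rightarrow> bool" where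
  "large A \<longleftrightarrow> A \<subseteq> V \<and> |A| =o |V|"

definition orient :: "('a \<Rightarrow> 'a \<Rightarrow> bool) \<Rightarrow> 'a rel" where
  "orient f = {(u, v). u \<in> V \<and> v \<in> V \<and> (u \<prec> v \<and> f u v \<or> v \<prec> u \<and> \<not> f v u)}"

lemma well_order_r: "well_order_on V r"
  using card_order_r by (simp add: card_order_on_def)

lemma Card_order_r: "Card_order r" and Field_r: "Field r = V"
  using card_order_on_Card_order[OF card_order_r] by auto

lemma less_in_V: "u \<prec> v \<Longrightarrow> u \<in> V" "u \<prec> v \<Longrightarrow> v \<in> V"
  unfolding less_def Field_r[symmetric] by (auto simp: Field_def)

lemma less_linear: "u \<in> V \<Longrightarrow> v \<in> V \<Longrightarrow> u \<prec> v \<or> u = v \<or> v \<prec> u"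
  using well_order_r
  by (auto simp: well_order_on_def linear_order_on_def total_on_def less_def)

lemma less_trans: "u \<prec> v \<Longrightarrow> v \<prec> w \<Longrightarrow> u \<prec> w"
  using well_order_r
  unfolding well_order_on_def linear_order_on_def partial_order_on_def preorder_on_def less_def
  by (meson antisymD transD)

lemma less_irrefl: "\<not> u \<prec> u"
  by (simp add: less_def)

lemma less_asym: "u \<prec> v \<Longrightarrow> \<not> v \<prec> u"
  using less_trans less_irrefl by blast

lemma wf_less: "wf {(u, v). u \<prec> v}"
proof -
  have "{(u, v). u \<prec> v} = r - Id" by (auto simp: less_def)
  then show ?thesis using well_order_r by (simp add: well_order_on_def)
qed

lemma orientation_complete_orient: "orientation_complete V (orient f)"
  unfolding orientation_complete_def orient_def
  using less_linear less_asym less_irrefl by auto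

lemma orient_less: "u \<prec> v \<Longrightarrow> (u, v) \<in> orient f \<longleftrightarrow> f u v"
  "u \<prec> v \<Longrightarrow> (v, u) \<in> orient f \<longleftrightarrow> \<not> f u v"
  using less_asym less_in_V by (auto simp: orient_def)

lemma large_subset: "large A \<Longrightarrow> A \<subseteq> V"
  by (simp add: large_def)

lemma large_mono: "large A \<Longrightarrow> A \<subseteq> B \<Longrightarrow> B \<subseteq> V \<Longrightarrow> large B"
  unfolding large_def
  by (meson card_of_mono1 ordIso_iff_ordLeq ordLeq_transitive)

lemma not_large_iff: "A \<subseteq> V \<Longrightarrow> \<not> large A \<longleftrightarrow> |A| <o |V|"
  unfolding large_def
  by (metis card_of_mono1 not_ordLess_ordIso ordLeq_iff_ordLess_or_ordIso)

text \<open>Since \<open>r\<close> is a cardinal order, the elements up to \<gamma> are fewer than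
  |V|, too few to cover \<open>A\<close>.\<close>

lemma large_unbounded:
  assumes "large A" "\<gamma> \<in> V"
  obtains a where "a \<in> A" "\<gamma> \<prec> a"
proof (rule ccontr)
  assume "\<not> thesis"
  then have A: "A \<subseteq> insert \<gamma> (underS r \<gamma>)"
    using that assms less_linear large_subset by (fastforce simp: underS_def less_def)
  have "|underS r \<gamma>| <o |V|"
    using card_of_underS[OF Card_order_r] assms(2) card_of_unique[OF card_order_r] Field_r
      ordLess_ordIso_trans by blast
  moreover have "|{\<gamma>}| <o |V|"
    using finite_ordLess_infinite[OF card_of_Well_order card_of_Well_order] infinite_V
    by (metis Field_card_of finite.emptyI finite_insert)
  ultimately have "|insert \<gamma> (underS r \<gamma>)| <o |V|"
    using card_of_Un_ordLess_infinite[OF infinite_V, of "{\<gamma>}" "underS r \<gamma>"] by simp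
  then have "|A| <o |V|" using card_of_mono1[OF A] ordLeq_ordLess_trans by blast
  then show False
    using assms(1) not_large_iff large_subset by blast
qed

lemma less_upper_bound:
  assumes "u \<in> V" "v \<in> V"
  obtains w where "w \<in> V" "\<And>a. a \<in> V \<Longrightarrow> w \<prec> a \<Longrightarrow> u \<prec> a \<and> v \<prec> a"
  using assms less_linear less_trans by metis

end

section \<open>Regular cardinals: bounds and thinning\<close>

locale infinite_regular_card = infinite_card +
  assumes regular: "regular_card V r"
begin

lemma small_bounded:
  assumes "A \<subseteq> V" "\<not> large A"
  obtains \<beta> where "\<beta> \<in> V" "\<And>\<alpha>. \<alpha> \<in> A \<Longrightarrow> \<not> \<beta> \<prec> \<alpha>"
proof -
  obtain \<beta> where "\<beta> \<in> V" "\<forall>\<alpha>\<in>A. (\<alpha>, \<beta>) \<in> r"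
    using regular assms not_large_iff unfolding regular_card_def by blast
  then show thesis
    using that less_asym less_irrefl unfolding less_def by metis
qed

text \<open>Greedy well-founded recursion: \<beta> in \<open>W\<close> is kept iff it lies above
  \<open>g \<alpha>\<close> for all smaller kept \<alpha>. Were the kept set small, regularity would
  bound it and its image, yet an element of \<open>W\<close> beyond both bounds would still be
  kept.\<close>

lemma large_thinning:
  assumes W: "large W" and g: "g ` W \<subseteq> V"
  obtains W' where "W' \<subseteq> W" "large W'" "\<And>\<alpha> \<beta>. \<alpha> \<in> W' \<Longrightarrow> \<beta> \<in> W' \<Longrightarrow> \<alpha> \<prec> \<beta> \<Longrightarrow> g \<alpha> \<prec> \<beta>"
proof -
  define R where "R = {(u, v). u \<prec> v}"
  define F where "F = (\<lambda>P \<beta>. \<beta> \<in> W \<and> (\<forall>\<alpha>. \<alpha> \<prec> \<beta> \<longrightarrow> P \<alpha> \<longrightarrow> g \<alpha> \<prec> \<beta>))"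
  define W' where "W' = {\<beta>. wfrec R F \<beta>}"
  \<comment> \<open>\<open>F\<close> consults its predicate only below \<beta>, so
    \<open>cut\<close> disappears on unfolding.\<close>
  have W'_iff: "\<beta> \<in> W' \<longleftrightarrow> \<beta> \<in> W \<and> (\<forall>\<alpha>\<in>W'. \<alpha> \<prec> \<beta> \<longrightarrow> g \<alpha> \<prec> \<beta>)" for \<beta>
  proof -
    have "wfrec R F \<beta> = F (cut (wfrec R F) R \<beta>) \<beta>"
      using wf_less by (simp add: wfrec R_def)
    then show ?thesis
      by (auto simp: W'_def F_def R_def cut_def)
  qed
  have sub: "W' \<subseteq> W" using W'_iff by blast
  then have sub_V: "W' \<subseteq> V" using W large_subset by blast
  have "large W'"
  proof (rule ccontr)
    assume small: "\<not> large W'"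
    have gV: "g ` W' \<subseteq> V" using g sub by blast
    have "|g ` W'| <o |V|"
      using small sub_V not_large_iff card_of_image ordLeq_ordLess_trans by blast
    then have small': "\<not> large (g ` W')" using gV not_large_iff by blast
    obtain \<gamma>1 where \<gamma>1: "\<gamma>1 \<in> V" "\<And>\<alpha>. \<alpha> \<in> W' \<Longrightarrow> \<not> \<gamma>1 \<prec> \<alpha>"
      using small_bounded[OF sub_V small] by blast
    obtain \<gamma>2 where \<gamma>2: "\<gamma>2 \<in> V" "\<And>\<alpha>. \<alpha> \<in> g ` W' \<Longrightarrow> \<not> \<gamma>2 \<prec> \<alpha>"
      using small_bounded[OF gV small'] by blast
    obtain w where w: "w \<in> V" "\<And>a. a \<in> V \<Longrightarrow> w \<prec> a \<Longrightarrow> \<gamma>1 \<prec> a \<and> \<gamma>2 \<prec> a"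
      using less_upper_bound \<gamma>1(1) \<gamma>2(1) by blast
    obtain \<beta> where \<beta>: "\<beta> \<in> W" "w \<prec> \<beta>"
      using large_unbounded[OF W w(1)] by blast
    then have *: "\<gamma>1 \<prec> \<beta>" "\<gamma>2 \<prec> \<beta>" using w(2) less_in_V by blast+
    have "g \<alpha> \<prec> \<beta>" if "\<alpha> \<in> W'" for \<alpha>
      using *(2) \<gamma>2 less_linear[of \<gamma>2 "g \<alpha>"] less_trans that gV by blast
    then have "\<beta> \<in> W'" using W'_iff \<beta>(1) by blast
    then show False using \<gamma>1(2) *(1) by blast
  qed
  then show thesis using that[OF sub] W'_iff by blast
qed

end

locale square_bracket_colouring = infinite_regular_card +
  fixes f :: "'a \<Rightarrow> 'a \<Rightarrow> bool"
  assumes bracket: "\<And>A B i. large A \<Longrightarrow> large B \<Longrightarrow> \<exists>\<alpha>\<in>A. \<exists>\<beta>\<in>B. \<alpha> \<prec> \<beta> \<and> f \<alpha> \<beta> = i"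
begin

definition nbrs :: "'a set \<Rightarrow> bool \<Rightarrow> 'a \<Rightarrow> 'a set" where
  "nbrs W i \<alpha> = {\<beta>\<in>W. \<alpha> \<prec> \<beta> \<and> f \<alpha> \<beta> = i}"

lemma nbrs_subset: "nbrs W i \<alpha> \<subseteq> W"
  by (auto simp: nbrs_def)

text \<open>Otherwise let \<open>g \<alpha>\<close> bound the neighbourhood of each exceptional
  \<alpha> and thin so that later vertices pass the earlier bounds. Colour \<open>i\<close> is then
  absent from the large set \<open>W'\<close>, against \<open>bracket\<close>.\<close>

lemma small_nbrs_not_large:
  assumes "W \<subseteq> V"
  shows "\<not> large {\<alpha>\<in>W. \<not> large (nbrs W i \<alpha>)}"
proof
  assume large: "large {\<alpha>\<in>W. \<not> large (nbrs W i \<alpha>)}" (is "large ?A")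
  have "\<exists>\<beta>\<in>V. \<forall>\<gamma>\<in>nbrs W i \<alpha>. \<not> \<beta> \<prec> \<gamma>" if "\<alpha> \<in> ?A" for \<alpha>
  proof -
    have "nbrs W i \<alpha> \<subseteq> V" "\<not> large (nbrs W i \<alpha>)" 
      using assms that nbrs_subset[of W i \<alpha>] by auto
    then show ?thesis by (rule small_bounded) blast
  qed
  then obtain g where g: "\<And>\<alpha>. \<alpha> \<in> ?A \<Longrightarrow> g \<alpha> \<in> V \<and> (\<forall>\<gamma>\<in>nbrs W i \<alpha>. \<not> g \<alpha> \<prec> \<gamma>)"
    by metis
  then have "g ` ?A \<subseteq> V" by blast
  from large_thinning[OF large this] obtain W' where
    W': "W' \<subseteq> ?A" "large W'" "\<And>\<alpha> \<beta>. \<alpha> \<in> W' \<Longrightarrow> \<beta> \<in> W' \<Longrightarrow> \<alpha> \<prec> \<beta> \<Longrightarrow> g \<alpha> \<prec> \<beta>"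
    by metis
  obtain \<alpha> \<beta> where "\<alpha> \<in> W'" "\<beta> \<in> W'" "\<alpha> \<prec> \<beta>" "f \<alpha> \<beta> = i"
    using bracket[OF W'(2) W'(2)] by blast
  then show False using W' g unfolding nbrs_def by blast
qed

text \<open>By regularity the exceptional vertices of either colour are bounded; any vertex of
  \<open>W\<close> beyond both bounds serves.\<close>

lemma ex_large_nbrs:
  assumes "large W"
  obtains \<alpha> where "\<alpha> \<in> W" "large (nbrs W True \<alpha>)" "large (nbrs W False \<alpha>)"
proof -
  let ?A = "\<lambda>i. {\<alpha>\<in>W. \<not> large (nbrs W i \<alpha>)}"
  have W: "W \<subseteq> V" using assms large_subset by blast
  have sub: "?A i \<subseteq> V" for i using W by blast
  obtain \<gamma>1 where \<gamma>1: "\<gamma>1 \<in> V" "\<And>\<alpha>. \<alpha> \<in> ?A True \<Longrightarrow> \<not> \<gamma>1 \<prec> \<alpha>"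
    using small_bounded[OF sub small_nbrs_not_large[OF W]] by blast
  obtain \<gamma>2 where \<gamma>2: "\<gamma>2 \<in> V" "\<And>\<alpha>. \<alpha> \<in> ?A False \<Longrightarrow> \<not> \<gamma>2 \<prec> \<alpha>"
    using small_bounded[OF sub small_nbrs_not_large[OF W]] by blast
  obtain w where w: "w \<in> V" "\<And>a. a \<in> V \<Longrightarrow> w \<prec> a \<Longrightarrow> \<gamma>1 \<prec> a \<and> \<gamma>2 \<prec> a"
    using less_upper_bound \<gamma>1(1) \<gamma>2(1) by blast
  obtain \<alpha> where "\<alpha> \<in> W" "w \<prec> \<alpha>"
    using large_unbounded[OF assms w(1)] by blast
  then show thesis
    using that[of \<alpha>] \<gamma>1 \<gamma>2 w W by blast
qed

lemma increasing_path:
  assumes "large A" "large B"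
  shows "\<exists>xs q. length xs = Suc m \<and> set xs \<subseteq> A \<and> q \<in> B \<and>
    successively (\<lambda>u v. u \<prec> v \<and> f u v) (xs @ [q])"
  using assms(1)
proof (induction m arbitrary: A)
  case 0
  then obtain p q where "p \<in> A" "q \<in> B" "p \<prec> q" "f p q"
    using bracket[OF _ assms(2), of A True] by blast
  then show ?case
    by (intro exI[of _ "[p]"] exI[of _ q]) simp
next
  case (Suc m)
  \<comment> \<open>The induction continues inside the out-neighbours of \<open>p\<close>, so
    \<open>p\<close> has an arc to whichever vertex comes next.\<close>
  obtain p where p: "p \<in> A" "large (nbrs A True p)"
    using ex_large_nbrs[OF Suc.prems] by blast
  from Suc.IH[OF p(2)] obtain xs q where
    xs: "length xs = Suc m" "set xs \<subseteq> nbrs A True p" "q \<in> B"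
      "successively (\<lambda>u v. u \<prec> v \<and> f u v) (xs @ [q])"
    by blast
  then obtain x xs' where x: "xs = x # xs'" by (cases xs) auto
  show ?case
    using p(1) xs x nbrs_subset[of A True p]
    by (intro exI[of _ "p # xs"] exI[of _ q]) (auto simp: nbrs_def)
qed

lemma dicycle_in_large:
  assumes "large W" "n \<ge> 3"
  shows "has_dicycle_in (orient f) W n"
proof -
  obtain x where x: "x \<in> W" "large (nbrs W True x)" "large (nbrs W False x)"
    using ex_large_nbrs[OF assms(1)] by blast
  \<comment> \<open>This puts \<open>n - 2\<close> vertices into \<open>xs\<close>; \<open>x\<close>
    and \<open>q\<close> complete the \<open>n\<close>, and the arc from \<open>q\<close> to
    \<open>x\<close> closes the cycle.\<close>
  from increasing_path[OF x(2,3), of "n - 3"] obtain xs q where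
    xs: "length xs = Suc (n - 3)" "set xs \<subseteq> nbrs W True x" "q \<in> nbrs W False x"
      "successively (\<lambda>u v. u \<prec> v \<and> f u v) (xs @ [q])"
    by blast
  let ?c = "x # xs @ [q]"
  obtain y ys where y: "xs = y # ys" using xs(1) by (cases xs) auto
  have q: "x \<prec> q" "\<not> f x q" "q \<in> W" using xs(3) by (auto simp: nbrs_def)
  have y_nbr: "x \<prec> y" "f x y" using xs(2) y by (auto simp: nbrs_def)
  have less: "successively (\<prec>) ?c"
    using xs(4) y y_nbr by (auto intro: successively_mono)
  have "transp (\<prec>)" using less_trans by (auto intro: transpI)
  then have "sorted_wrt (\<prec>) ?c"
    using less by (simp only: successively_conv_sorted_wrt)
  then have dist: "distinct ?c"
    using less_irrefl by (metis distinct_conv_nth linorder_neqE_nat sorted_wrt_iff_nth_less)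
  have arcs: "successively (\<lambda>u v. (u, v) \<in> orient f) (xs @ [q])"
    using xs(4) by (rule successively_mono) (auto simp: orient_less)
  have "has_dicycle_in (orient f) W (length ?c)"
  proof (rule has_dicycle_in_path[OF dist])
    show "set ?c \<subseteq> W" using x(1) xs(2) q(3) nbrs_subset by force
    show "successively (\<lambda>u v. (u, v) \<in> orient f) ?c"
      using arcs y y_nbr by (simp add: orient_less)
    show "(last ?c, hd ?c) \<in> orient f" using q by (simp add: orient_less)
  qed simp
  moreover have "length ?c = n" using xs(1) assms(2) by simp
  ultimately show ?thesis by simp
qed

end

context infinite_card
begin

text \<open>Identify \<open>(V \<times> V) \<times> V\<close> with \<open>V\<close> and let
  \<open>l\<close> forget the last coordinate: each fibre contains a copy of
  \<open>V\<close>.\<close>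

lemma ex_large_fibres:
  obtains l :: "'a \<Rightarrow> 'a \<times> 'a"
  where "\<And>a b. a \<in> V \<Longrightarrow> b \<in> V \<Longrightarrow> large {v\<in>V. l v = (a, b)}"
proof -
  have "|V \<times> V| =o |V|" using infinite_V by (rule card_of_Times_same_infinite)
  then have "|(V \<times> V) \<times> V| =o |V|"
    using card_of_Times_mono1 ordIso_iff_ordLeq ordIso_transitive by metis
  then obtain h where h: "bij_betw h ((V \<times> V) \<times> V) V"
    using card_of_ordIso by blast
  define l where "l v = fst (the_inv_into ((V \<times> V) \<times> V) h v)" for v
  have "large {v\<in>V. l v = (a, b)}" if "a \<in> V" "b \<in> V" for a b
  proof -
    let ?h = "\<lambda>v. h ((a, b), v)"
    have inj: "inj_on ?h V"
      using h that by (auto simp: bij_betw_def inj_on_def)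
    have sub: "?h ` V \<subseteq> V" using h that by (auto simp: bij_betw_def)
    have "|?h ` V| =o |V|"
      using inj by (meson card_of_ordIsoI inj_on_imp_bij_betw ordIso_symmetric)
    then have "large (?h ` V)" using sub by (simp add: large_def)
    moreover have "?h ` V \<subseteq> {v\<in>V. l v = (a, b)}"
      using sub h that by (auto simp: l_def bij_betw_def the_inv_into_f_f)
    ultimately show ?thesis by (rule large_mono) blast
  qed
  then show thesis by (rule that)
qed

text \<open>Subsets of \<open>V\<close> that are not large have size at most |L|, and a union of |L|
  such sets still has size at most |L|.\<close>

lemma large_pigeonhole:
  fixes L :: "'b set"
  assumes succ: "|V| =o cardSuc |L|" and "infinite L" and A: "large A" and c: "c ` A \<subseteq> L"
  obtains k where "k \<in> L" "large {a\<in>A. c a = k}"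
proof (rule ccontr)
  assume "\<not> thesis"
  with that have *: "k \<in> L \<Longrightarrow> \<not> large {a\<in>A. c a = k}" for k by blast
  have small: "|B| \<le>o |L|" if "B \<subseteq> V" "\<not> large B" for B
    using that not_large_iff succ
    by (meson card_of_Card_order cardSuc_ordLeq_ordLess ordLess_ordIso_trans)
  have "|\<Union>k\<in>L. {a\<in>A. c a = k}| \<le>o |L|"
  proof (rule card_of_UNION_ordLeq_infinite[OF \<open>infinite L\<close>])
    show "|L| \<le>o |L|" by (rule ordLeq_refl[OF card_of_Card_order])
    have "{a\<in>A. c a = k} \<subseteq> V" for k using large_subset[OF A] by blast
    then show "\<forall>k\<in>L. |{a\<in>A. c a = k}| \<le>o |L|" using * small by blast
  qed
  moreover have "A = (\<Union>k\<in>L. {a\<in>A. c a = k})" using c by blast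
  ultimately have "|A| \<le>o |L|" by simp
  moreover have "|L| <o |V|"
    using succ cardSuc_greater[OF card_of_Card_order] ordIso_symmetric ordLess_ordIso_trans
    by blast
  ultimately have "|A| <o |V|" by (rule ordLeq_ordLess_trans)
  then show False using A not_large_iff large_subset by blast
qed

definition label_col :: "('a \<Rightarrow> 'a \<times> 'a) \<Rightarrow> 'a \<Rightarrow> 'a \<Rightarrow> bool" where
  "label_col l u v \<longleftrightarrow> \<not> u \<prec> fst (l v) \<and> u \<prec> snd (l v)"

text \<open>\<open>W\<close> stands for a colour class; \<open>step\<close> lets suitable intervals
  be found arbitrarily far up.\<close>

lemma dicycle_of_labels:
  assumes W: "W \<subseteq> V"
    and step: "\<And>\<gamma>. \<gamma> \<in> V \<Longrightarrow> \<exists>a x b. \<gamma> \<prec> a \<and> a \<prec> x \<and> x \<prec> b \<and> x \<in> W \<and> large {v\<in>W. l v = (a, b)}"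
    and n: "n \<ge> 3"
  shows "has_dicycle_in (orient (label_col l)) W n"
proof -
  let ?ok = "\<lambda>(a, x, b). a \<prec> x \<and> x \<prec> b \<and> x \<in> W \<and> large {v\<in>W. l v = (a, b)}"
  \<comment> \<open>Each triple starts beyond the end of the previous one, which makes the intervals
    disjoint.\<close>
  have "\<exists>t. \<forall>k. ?ok (t k) \<and> snd (snd (t k)) \<prec> fst (t (Suc k))"
  proof (rule dependent_nat_choice)
    obtain \<gamma> where "\<gamma> \<in> V" using infinite_V by fastforce
    from step[OF this] show "\<exists>t. ?ok t" by auto
    fix t :: "'a \<times> 'a \<times> 'a" and k :: nat
    assume "?ok t"
    then have "snd (snd t) \<in> V" using less_in_V by auto
    from step[OF this] show "\<exists>t'. ?ok t' \<and> snd (snd t) \<prec> fst t'" by fastforce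
  qed
  then obtain t where t: "\<forall>k. ?ok (t k) \<and> snd (snd (t k)) \<prec> fst (t (Suc k))" ..
  define a x b where "a k = fst (t k)" and "x k = fst (snd (t k))" and "b k = snd (snd (t k))" for k
  have ax: "a k \<prec> x k" and xb: "x k \<prec> b k" and xW: "x k \<in> W"
    and large_ab: "large {v\<in>W. l v = (a k, b k)}" and ba: "b k \<prec> a (Suc k)" for k
    using t[rule_format, of k] by (auto simp: a_def x_def b_def split: prod.splits)
  have b_a: "b j \<prec> a k" if "j < k" for j k
    using that
  proof (induction k)
    case (Suc k)
    then show ?case
      using ba[of k] ax[of k] xb[of k] less_trans less_antisym by metis
  qed simp
  have x_outside: "x j \<prec> a k \<or> b k \<prec> x j" if "j \<noteq> k" for j k
    using that b_a[of j k] b_a[of k j] xb[of j] ax[of j] less_trans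
    by (meson linorder_neqE_nat)
  have b_le: "b j = b k \<or> b j \<prec> b k" if "j \<le> k" for j k
    using that b_a[of j k] ax[of k] xb[of k] less_trans by (metis le_neq_implies_less)
  \<comment> \<open>For odd \<open>n\<close> the cycle on \<open>n + 1\<close> vertices loses its
    first vertex \<open>x 0\<close>; \<open>s\<close> is this shift and \<open>m\<close> the last
    index.\<close>
  define s where "s = n mod 2"
  define m where "m = (n + s) div 2 - 1"
  have n_eq: "n + s = 2 * m + 2" and m: "m \<ge> 1" and s: "s \<le> 1"
    using n unfolding s_def m_def by presburger+
  have bV: "b m \<in> V" using xb less_in_V by blast
  \<comment> \<open>Lying above \<open>b m\<close> puts the \<open>p k\<close> above all
    \<open>x j\<close> with \<open>j \<le> m\<close>. \<open>p0\<close> is chosen first so that the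
    others can be taken above it.\<close>
  obtain p0 where p0: "p0 \<in> W" "l p0 = (a 0, b 0)" "b m \<prec> p0"
    using large_unbounded[OF large_ab[of 0] bV] by blast
  have "\<exists>p. p \<in> W \<and> l p = (a k, b k) \<and> p0 \<prec> p" for k
    using large_unbounded[OF large_ab[of k], of p0] less_in_V(2)[OF p0(3)] by blast
  then obtain p' where p': "\<And>k. p' k \<in> W \<and> l (p' k) = (a k, b k) \<and> p0 \<prec> p' k" by metis
  define p where "p k = (if k = 0 then p0 else p' k)" for k
  have pW: "p k \<in> W" and lp: "l (p k) = (a k, b k)" and bp: "b m \<prec> p k" for k
    using p0 p' less_trans by (auto simp: p_def)
  have p0_less: "p 0 \<prec> p m" using p' m by (simp add: p_def)
  have xp: "x j \<prec> p k" if "j \<le> m" for j k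
    using xb[of j] b_le[OF that] bp[of k] less_trans by metis
  have x_p: "(x k, p k) \<in> orient (label_col l)" if "k \<le> m" for k
    using xp[OF that] ax xb lp less_asym by (simp add: orient_less label_col_def)
  have p_x: "(p k, x j) \<in> orient (label_col l)" if "j \<le> m" "j \<noteq> k" for j k
    using xp[OF that(1)] x_outside[OF that(2)] lp less_asym
    by (auto simp: orient_less label_col_def)
  \<comment> \<open>\<open>p 0\<close> is above \<open>b m\<close>, hence outside the interval of
    \<open>p m\<close>, so the arc points downwards.\<close>
  have p_p: "(p m, p 0) \<in> orient (label_col l)"
    using p0_less bp[of 0] lp less_asym by (auto simp: orient_less label_col_def)
  have inj_x: "x j \<noteq> x k" if "j \<noteq> k" for j k
    using x_outside[OF that] ax xb less_asym by metis
  \<comment> \<open>Equal vertices would carry equal labels, although the intervals are disjoint and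
    nonempty.\<close>
  have inj_p: "p j \<noteq> p k" if "j \<noteq> k" for j k
  proof
    assume "p j = p k"
    then have "a j = a k" "b j = b k" using lp by (metis prod.inject)+
    then show False using x_outside[OF that] ax[of j] xb[of j] less_asym by metis
  qed
  define z where "z i = (if even i then x (i div 2) else p (i div 2))" for i
  have z_arc: "(z i, z (Suc i)) \<in> orient (label_col l)" if "Suc i < 2 * m + 2" for i
  proof (cases "even i")
    case True
    then show ?thesis using x_p[of "i div 2"] that by (simp add: z_def)
  next
    case False
    then obtain k where "i = 2 * k + 1" by (rule oddE)
    then show ?thesis using p_x[of "Suc k" k] that by (simp add: z_def)
  qed
  have z_inj: "z i \<noteq> z j" if "i < j" "j < 2 * m + 2" for i j
  proof -
    have *: "i div 2 \<le> m" "j div 2 \<le> m" using that by auto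
    have "i div 2 \<noteq> j div 2" if "even i = even j"
      using that \<open>i < j\<close> by presburger
    then show ?thesis
      using inj_x inj_p xp[OF *(1)] xp[OF *(2)] less_irrefl unfolding z_def by metis
  qed
  show ?thesis
    unfolding has_dicycle_in_def
  proof (intro exI[of _ "\<lambda>i. z (i + s)"] conjI allI impI)
    show "inj_on (\<lambda>i. z (i + s)) {..<n}"
      using z_inj n_eq by (intro linorder_inj_onI) auto
    show "(\<lambda>i. z (i + s)) ` {..<n} \<subseteq> W"
      using xW pW by (auto simp: z_def)
    fix i assume i: "i < n"
    show "(z (i + s), z (Suc i mod n + s)) \<in> orient (label_col l)"
    proof (cases "Suc i = n")
      case True
      then have "i + s = 2 * m + 1" using n_eq by simp
      then have "z (i + s) = p m" by (simp add: z_def)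
      \<comment> \<open>The closing arc from \<open>p m\<close> ends in \<open>x 0\<close> for even
        \<open>n\<close> and in \<open>p 0\<close> for odd \<open>n\<close>.\<close>
      moreover have "z s = (if s = 0 then x 0 else p 0)" using s by (auto simp: z_def)
      ultimately show ?thesis using True p_x[of 0 m] p_p m by simp
    next
      case False
      then show ?thesis using z_arc[of "i + s"] i n_eq by simp
    qed
  qed
qed

text \<open>The colour is fixed before the length, so one class contains cycles of all
  lengths.\<close>

lemma dicycle_monochromatic:
  fixes L :: "'b set" and c :: "'a \<Rightarrow> 'b"
  assumes succ: "|V| =o cardSuc |L|" and inf: "infinite L" and c: "c ` V \<subseteq> L"
    and l: "\<And>a b. a \<in> V \<Longrightarrow> b \<in> V \<Longrightarrow> large {v\<in>V. l v = (a, b)}"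
  obtains k where "k \<in> L" "\<And>n. n \<ge> 3 \<Longrightarrow> has_dicycle_in (orient (label_col l)) {v\<in>V. c v = k} n"
proof -
  note pigeonhole = large_pigeonhole[OF succ inf]
  have large_V: "large V" by (simp add: large_def card_of_refl)
  have "\<exists>k\<in>L. large {v\<in>{v\<in>V. l v = (a, b)}. c v = k}" if "a \<in> V" "b \<in> V" for a b
  proof -
    have "c ` {v\<in>V. l v = (a, b)} \<subseteq> L" using c by blast
    from pigeonhole[OF l[OF that] this] show ?thesis by blast
  qed
  \<comment> \<open>\<open>c2 a b\<close> is a frequent colour among vertices labelled
    \<open>(a, b)\<close>; below, \<open>c1 a\<close> is frequent among the \<open>c2 a b\<close>,
    and \<open>k\<close> among the \<open>c1 a\<close>.\<close>
  then obtain c2 where c2: "\<And>a b. a \<in> V \<Longrightarrow> b \<in> V \<Longrightarrow>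
      c2 a b \<in> L \<and> large {v\<in>{v\<in>V. l v = (a, b)}. c v = c2 a b}"
    by metis
  have "\<exists>k\<in>L. large {b\<in>V. c2 a b = k}" if "a \<in> V" for a
  proof -
    have "c2 a ` V \<subseteq> L" using c2 that by blast
    from pigeonhole[OF large_V this] show ?thesis by blast
  qed
  then obtain c1 where c1: "\<And>a. a \<in> V \<Longrightarrow> c1 a \<in> L \<and> large {b\<in>V. c2 a b = c1 a}"
    by metis
  then have "c1 ` V \<subseteq> L" by blast
  then obtain k where k: "k \<in> L" "large {a\<in>V. c1 a = k}"
    using pigeonhole[OF large_V, of c1] by blast
  let ?W = "{v\<in>V. c v = k}"
  have fibre: "large {v\<in>?W. l v = (a, b)}" if "a \<in> V" "b \<in> V" "c2 a b = k" for a b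
    using c2[OF that(1,2)] that(3) by (elim conjE large_mono) auto
  have step: "\<exists>a x b. \<gamma> \<prec> a \<and> a \<prec> x \<and> x \<prec> b \<and> x \<in> ?W \<and> large {v\<in>?W. l v = (a, b)}"
    if \<gamma>: "\<gamma> \<in> V" for \<gamma>
  proof -
    obtain a where a: "a \<in> V" "c1 a = k" "\<gamma> \<prec> a"
      using large_unbounded[OF k(2) \<gamma>] by blast
    have large_b: "large {b\<in>V. c2 a b = k}" using c1[OF a(1)] a(2) by simp
    \<comment> \<open>\<open>b'\<close> only witnesses that \<open>?W\<close> contains a large
      fibre, so that \<open>x\<close> can be taken above \<open>a\<close> before \<open>b\<close> is
      taken above \<open>x\<close>.\<close>
    obtain b' where "b' \<in> V" "c2 a b' = k" using large_unbounded[OF large_b a(1)] by blast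
    then obtain x where x: "x \<in> ?W" "a \<prec> x"
      using large_unbounded[OF fibre[OF a(1)] a(1)] by blast
    obtain b where b: "b \<in> V" "c2 a b = k" "x \<prec> b"
      using large_unbounded[OF large_b] x(1) by blast
    show ?thesis using a x b fibre by blast
  qed
  show thesis
    using dicycle_of_labels[OF _ step] by (intro that[OF k(1)]) blast
qed

end

section \<open>Both claims, by instantiating the locales at the given cardinals\<close>

theorem theorem4p1:
  shows "(\<forall>(V :: 'a set) r. infinite V \<and> card_order_on V r \<and> regular_card V r \<and>
            neg_square_bracket V r \<longrightarrow>
            (\<exists>D. orientation_complete V D \<and>
               (\<forall>W n. W \<subseteq> V \<and> |W| =o |V| \<and> n \<ge> 3 \<longrightarrow> has_dicycle_in D W n)))
       \<and> (\<forall>(L :: 'b set) (V :: 'a set). \<not> countable L \<and> |V| =o cardSuc |L| \<longrightarrow>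
            (\<exists>D. orientation_complete V D \<and>
               (\<forall>(c :: 'a \<Rightarrow> 'b) n. c ` V \<subseteq> L \<and> n \<ge> 3 \<longrightarrow>
                  (\<exists>k\<in>L. has_dicycle_in D {v\<in>V. c v = k} n))))"
proof (intro conjI allI impI; elim conjE)
  fix V :: "'a set" and r
  assume "infinite V" "card_order_on V r" "regular_card V r" "neg_square_bracket V r"
  then interpret infinite_regular_card V r by unfold_locales
  obtain f :: "'a \<Rightarrow> 'a \<Rightarrow> bool" where f: "\<forall>A B. A \<subseteq> V \<and> B \<subseteq> V \<and> |A| =o |V| \<and> |B| =o |V| \<longrightarrow>
      (\<forall>i. \<exists>\<alpha>\<in>A. \<exists>\<beta>\<in>B. (\<alpha>, \<beta>) \<in> r \<and> \<alpha> \<noteq> \<beta> \<and> f \<alpha> \<beta> = i)"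
    using \<open>neg_square_bracket V r\<close> unfolding neg_square_bracket_def by blast
  interpret square_bracket_colouring V r f
    using f by unfold_locales (simp add: large_def less_def conj_assoc)
  show "\<exists>D. orientation_complete V D \<and>
      (\<forall>W n. W \<subseteq> V \<and> |W| =o |V| \<and> n \<ge> 3 \<longrightarrow> has_dicycle_in D W n)"
    using orientation_complete_orient dicycle_in_large unfolding large_def by blast
next
  fix L :: "'b set" and V :: "'a set"
  assume L: "\<not> countable L" and succ: "|V| =o cardSuc |L|"
  have inf: "infinite L" using L countable_finite by blast
  then have "infinite V"
    using cardSuc_finite[OF card_of_Card_order, of L] Field_card_of[of L]
      card_of_ordIso_finite_Field[OF cardSuc_Card_order[OF card_of_Card_order]
        ordIso_symmetric[OF succ]]
    by simp
  then interpret infinite_card V "|V|"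
    by unfold_locales (auto simp: card_of_card_order_on)
  obtain l where l: "\<And>a b. a \<in> V \<Longrightarrow> b \<in> V \<Longrightarrow> large {v\<in>V. l v = (a, b)}"
    using ex_large_fibres by blast
  have "\<exists>k\<in>L. has_dicycle_in (orient (label_col l)) {v\<in>V. c v = k} n"
    if "c ` V \<subseteq> L" "n \<ge> 3" for c :: "'a \<Rightarrow> 'b" and n
    using dicycle_monochromatic[OF succ inf that(1) l] that(2) by metis
  then show "\<exists>D. orientation_complete V D \<and>
      (\<forall>(c :: 'a \<Rightarrow> 'b) n. c ` V \<subseteq> L \<and> n \<ge> 3 \<longrightarrow>
         (\<exists>k\<in>L. has_dicycle_in D {v\<in>V. c v = k} n))"
    using orientation_complete_orient by blast
qed

end
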